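(* For any fixed $\omega \in \mathbb{R}$, if $0 \notin K^n(j\omega)$ and $$\min\Big\{ \Re \frac{g_{i_1 j_1}(j\omega)}{f_{i_2 j_2}(j\omega)} \;:\; (i_1\, j_1\, i_2\, j_2) \in I_1 \Big\} =: \beta_0 > 0,$$ then $$\min\Big\{ \Re \frac{g(j\omega)}{f(j\omega)} \;:\; g(s)\in K^m(s),\ f(s)\in K^n(s) \Big\} = \beta_0 .$$
   Context: $j$ (not as a subscript) is the imaginary unit. Let $m\le n$, and let real numbers $a_i^-\le a_i^+$ ($0\le i\le m$), $b_i^-\le b_i^+$ ($0\le i\le n$) be given. The $m$-th and $n$-th order real interval polynomials are $$K^m(s)=\Big\{\sum_{i=0}^m a_i s^i : a_i\in[a_i^-,a_i^+]\Big\},\qquad K^n(s)=\Big\{\sum_{i=0}^n b_i s^i : b_i\in[b_i^-,b_i^+]\Big\},$$ and $K^n(j\omega)=\{f(j\omega): f\in K^n(s)\}$. Define (sums truncated at degree $m$) $\alpha_g^{(1)}(s^2)=a_0^-+a_2^+s^2+a_4^-s^4+a_6^+s^6+\cdots$, $\alpha_g^{(2)}(s^2)=a_0^++a_2^-s^2+a_4^+s^4+a_6^-s^6+\cdots$, $\beta_g^{(1)}(s^2)=a_1^-+a_3^+s^2+a_5^-s^4+a_7^+s^6+\cdots$, $\beta_g^{(2)}(s^2)=a_1^++a_3^-s^2+a_5^+s^4+a_7^-s^6+\cdots$, and $g_{ik}(s)=\alpha_g^{(i)}(s^2)+s\,\beta_g^{(k)}(s^2)\in K^m(s)$ for $i,k\in\{1,2\}$.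 The polynomials $f_{ik}(s)\in K^n(s)$ are defined in the same way from the bounds $b_i^\pm$. The index set is $I_1=\{(1222),(1221),(2221),(2211),(2111),(2112),(1112),(1122),(1211),(2212),(2122),(1121)\}$, where $(i_1\,j_1\,i_2\,j_2)$ is a 4-tuple with entries in $\{1,2\}$. *)

theory Defs
  imports Complex_Main "HOL-Computational_Algebra.Polynomial"
begin

definition interval_polys :: "nat \<Rightarrow> (nat \<Rightarrow> real) \<Rightarrow> (nat \<Rightarrow> real) \<Rightarrow> real poly set" where
  "interval_polys m lo up =
     {(\<Sum>i\<le>m. monom (a i) i) | a. \<forall>i\<le>m. a i \<in> {lo i..up i}}"

definition eval_j :: "real poly \<Rightarrow> real \<Rightarrow> complex" where
  "eval_j p \<omega> = poly (map_poly complex_of_real p) (\<i> * complex_of_real \<omega>)"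

text \<open>
  For \<open>i = 1\<close> the bounds occur in the order lower, upper, lower, upper, and so on;
  for \<open>i = 2\<close> in the order upper, lower, upper, lower, and so on.  The polynomials
  \<open>corner_alpha\<close> and \<open>corner_beta\<close> are polynomials in the variable \<open>s\<^sup>2\<close>; only the indices
  \<open>i = 1\<close> and \<open>i = 2\<close> are meaningful.
\<close>

definition alternating_bound :: "(nat \<Rightarrow> real) \<Rightarrow> (nat \<Rightarrow> real) \<Rightarrow> nat \<Rightarrow> nat \<Rightarrow> nat \<Rightarrow> real" where
  "alternating_bound lo up i k l = (if odd i \<longleftrightarrow> even k then lo l else up l)"

definition corner_alpha :: "nat \<Rightarrow> (nat \<Rightarrow> real) \<Rightarrow> (nat \<Rightarrow> real) \<Rightarrow> nat \<Rightarrow> real poly" where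
  "corner_alpha m lo up i =
     (\<Sum>k | 2 * k \<le> m. monom (alternating_bound lo up i k (2 * k)) k)"

definition corner_beta :: "nat \<Rightarrow> (nat \<Rightarrow> real) \<Rightarrow> (nat \<Rightarrow> real) \<Rightarrow> nat \<Rightarrow> real poly" where
  "corner_beta m lo up i =
     (\<Sum>k | 2 * k + 1 \<le> m. monom (alternating_bound lo up i k (2 * k + 1)) k)"

definition corner_poly :: "nat \<Rightarrow> (nat \<Rightarrow> real) \<Rightarrow> (nat \<Rightarrow> real) \<Rightarrow> nat \<Rightarrow> nat \<Rightarrow> real poly" where
  "corner_poly m lo up i k =
     pcompose (corner_alpha m lo up i) (monom 1 2)
     + monom 1 1 * pcompose (corner_beta m lo up k) (monom 1 2)"

definition I1 :: "(nat \<times> nat \<times> nat \<times> nat) set" where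
  "I1 = {(1,2,2,2), (1,2,2,1), (2,2,2,1), (2,2,1,1), (2,1,1,1), (2,1,1,2),
         (1,1,1,2), (1,1,2,2), (1,2,1,1), (2,2,1,2), (2,1,2,2), (1,1,2,1)}"

definition is_minimum :: "real set \<Rightarrow> real \<Rightarrow> bool" where
  "is_minimum S x \<longleftrightarrow> x \<in> S \<and> (\<forall>y\<in>S. x \<le> y)"

end

theory Submission
  imports Defs
begin

text \<open>
  Fix \<open>\<omega>\<close>.  The values \<open>f (\<i>\<omega>)\<close> of an interval polynomial fill an axis-parallel rectangle \<open>F\<close>,
  because the real part depends only on the even coefficients and the imaginary part only on the
  odd ones; the alternating choices of bounds minimise or maximise each part, so the corner
  polynomials give exactly the corners of the rectangle (lemmas \<open>eval_j_coeffs\<close>,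
  \<open>even_value_bounds\<close>, \<open>odd_value_bounds\<close>).  The same holds for the numerator, with a
  rectangle \<open>G\<close>.

  For \<open>\<beta> > 0\<close> and \<open>f \<noteq> 0\<close>, the condition \<open>Re (g / f) \<ge> \<beta>\<close> says
  \<open>Re (g * cnj f) \<ge> \<beta> * \<bar>f\<bar>\<^sup>2\<close>.  For fixed \<open>g\<close> the solutions \<open>f\<close> of this inequality form a
  disc with the origin on its boundary; what matters is that this set is convex and contains the
  origin (lemma \<open>margin_convex\<close>).  For fixed \<open>f\<close> the inequality is linear in \<open>g\<close>, so the worst
  \<open>g \<in> G\<close> is a corner, which is determined by the quadrant containing \<open>f\<close>.

  Now let \<open>f \<in> F\<close> lie in, say, the first quadrant, so that the lower left corner of \<open>G\<close>
  is the worst numerator.  Follow the ray from the origin through \<open>f\<close> until it leaves \<open>F\<close>.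
  This happens on the upper or on the right edge of \<open>F\<close>, so both end points of the edge are among
  the three corners of \<open>F\<close> other than the lower left one.  If the inequality holds at these three
  corners, then by convexity it holds at the exit point, and again by convexity at \<open>f\<close>,
  which lies between the origin and the exit point (lemma \<open>margin_first_quadrant\<close>).  The four
  quadrants, with three corners of \<open>F\<close> each, account for the twelve elements of \<open>I1\<close>.  The
  assumption that \<open>0 \<notin> F\<close> serves to divide by \<open>\<bar>f\<bar>\<^sup>2\<close>.
\<close>

section \<open>Values of interval polynomials on the imaginary axis\<close>

definition even_value :: "nat \<Rightarrow> real \<Rightarrow> (nat \<Rightarrow> real) \<Rightarrow> real" where
  "even_value m \<omega> a = (\<Sum>k | 2 * k \<le> m. a (2 * k) * (- (\<omega>\<^sup>2)) ^ k)"

definition odd_value :: "nat \<Rightarrow> real \<Rightarrow> (nat \<Rightarrow> real) \<Rightarrow> real" where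
  "odd_value m \<omega> a = (\<Sum>k | 2 * k + 1 \<le> m. a (2 * k + 1) * (- (\<omega>\<^sup>2)) ^ k)"

definition corner_coeff ::
    "(nat \<Rightarrow> real) \<Rightarrow> (nat \<Rightarrow> real) \<Rightarrow> nat \<Rightarrow> nat \<Rightarrow> nat \<Rightarrow> real" where
  "corner_coeff lo up i k l = alternating_bound lo up (if even l then i else k) (l div 2) l"

lemma finite_even_indices: "finite {k::nat. 2 * k \<le> m}"
  by (rule finite_subset[of _ "{..m}"]) auto

lemma finite_odd_indices: "finite {k::nat. 2 * k + 1 \<le> m}"
  by (rule finite_subset[of _ "{..m}"]) auto

lemma sum_even_odd_split:
  fixes F :: "nat \<Rightarrow> 'a::comm_monoid_add"
  shows "(\<Sum>i\<le>m. F i) = (\<Sum>k | 2 * k \<le> m. F (2 * k)) + (\<Sum>k | 2 * k + 1 \<le> m. F (2 * k + 1))"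
proof -
  have "{..m} = (\<lambda>k. 2 * k) ` {k. 2 * k \<le> m} \<union> (\<lambda>k. 2 * k + 1) ` {k. 2 * k + 1 \<le> m}"
    (is "_ = ?E \<union> ?O")
  proof (intro equalityI subsetI)
    fix i assume i: "i \<in> {..m}"
    show "i \<in> ?E \<union> ?O"
    proof (cases "even i")
      case True
      with i have "i \<in> ?E"
        by (intro image_eqI[of _ _ "i div 2"]) simp_all
      then show ?thesis ..
    next
      case False
      with i have "i \<in> ?O"
        by (intro image_eqI[of _ _ "i div 2"]) (simp_all flip: odd_two_times_div_two_succ)
      then show ?thesis ..
    qed
  qed auto
  moreover have "even i" if "i \<in> ?E" for i
    using that by auto
  then have "?E \<inter> ?O = {}"
    by fastforce
  ultimately have "(\<Sum>i\<le>m. F i) = sum F ?E + sum F ?O"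
    using finite_even_indices[of m] finite_odd_indices[of m]
    by (simp add: sum.union_disjoint)
  also have "sum F ?E = (\<Sum>k | 2 * k \<le> m. F (2 * k))"
    by (subst sum.reindex) (auto simp: inj_on_def)
  also have "sum F ?O = (\<Sum>k | 2 * k + 1 \<le> m. F (2 * k + 1))"
    by (subst sum.reindex) (auto simp: inj_on_def)
  finally show ?thesis .
qed

lemma eval_j_sum_monom:
  "eval_j (\<Sum>i\<le>m. monom (a i) i) \<omega> = (\<Sum>i\<le>m. complex_of_real (a i) * (\<i> * complex_of_real \<omega>) ^ i)"
proof -
  have "map_poly complex_of_real (\<Sum>i\<le>m. monom (a i) i) = (\<Sum>i\<le>m. monom (complex_of_real (a i)) i)"
    by (rule poly_eqI) (simp add: coeff_map_poly coeff_sum if_distrib)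
  then show ?thesis
    by (simp add: eval_j_def poly_sum poly_monom)
qed

lemma eval_j_coeffs:
  "eval_j (\<Sum>i\<le>m. monom (a i) i) \<omega> = Complex (even_value m \<omega> a) (\<omega> * odd_value m \<omega> a)"
proof -
  have even: "complex_of_real c * (\<i> * complex_of_real \<omega>) ^ (2 * k) = of_real (c * (- (\<omega>\<^sup>2)) ^ k)"
    for c k
    by (simp add: power_mult power_mult_distrib)
  have odd: "complex_of_real c * (\<i> * complex_of_real \<omega>) ^ (2 * k + 1) =
      \<i> * of_real \<omega> * of_real (c * (- (\<omega>\<^sup>2)) ^ k)" for c k
    by (simp add: power_add power_mult power_mult_distrib)
  have "eval_j (\<Sum>i\<le>m. monom (a i) i) \<omega> =
      of_real (even_value m \<omega> a) + \<i> * of_real \<omega> * of_real (odd_value m \<omega> a)"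
    unfolding eval_j_sum_monom sum_even_odd_split[of "\<lambda>i. complex_of_real (a i) * _ ^ i"] even odd
      even_value_def odd_value_def of_real_sum sum_distrib_left ..
  then show ?thesis
    by (simp add: complex_eq_iff)
qed

lemma corner_poly_coeffs:
  "corner_poly m lo up i k = (\<Sum>l\<le>m. monom (corner_coeff lo up i k l) l)"
proof -
  have pc: "pcompose (monom c l) (monom 1 2) = monom c (2 * l)" for c :: real and l
    by (rule poly_eq_poly_eq_iff[THEN iffD1])
      (simp add: fun_eq_iff poly_pcompose poly_monom power_mult)
  have "corner_poly m lo up i k =
      (\<Sum>l | 2 * l \<le> m. monom (alternating_bound lo up i l (2 * l)) (2 * l)) +
      (\<Sum>l | 2 * l + 1 \<le> m. monom (alternating_bound lo up k l (2 * l + 1)) (2 * l + 1))"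
    by (simp add: corner_poly_def corner_alpha_def corner_beta_def pcompose_sum pc
        sum_distrib_left mult_monom)
  then show ?thesis
    by (simp add: sum_even_odd_split corner_coeff_def)
qed

lemma corner_poly_in_interval_polys:
  assumes "\<And>i. i \<le> m \<Longrightarrow> lo i \<le> up i"
  shows "corner_poly m lo up i k \<in> interval_polys m lo up"
  unfolding interval_polys_def corner_poly_coeffs
  using assms by (auto simp: corner_coeff_def alternating_bound_def)

lemma eval_j_corner_poly:
  "eval_j (corner_poly m lo up i k) \<omega> =
     Complex (even_value m \<omega> (corner_coeff lo up i i)) (\<omega> * odd_value m \<omega> (corner_coeff lo up k k))"
  by (simp add: corner_poly_coeffs eval_j_coeffs even_value_def odd_value_def corner_coeff_def)

text \<open>
  The signs of \<open>(- \<omega>\<^sup>2) ^ k\<close> alternate in \<open>k\<close> exactly as the chosen bounds do, so each summand is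
  extremal by itself.  This holds for every sign of \<open>\<omega>\<close> because the factor \<open>\<omega>\<close> of the imaginary
  part is kept outside \<open>odd_value\<close>.
\<close>

lemma alternating_term_bounds:
  fixes \<omega> :: real
  assumes "lo l \<le> c" "c \<le> up l"
  shows "alternating_bound lo up 1 k l * (- (\<omega>\<^sup>2)) ^ k \<le> c * (- (\<omega>\<^sup>2)) ^ k"
    and "c * (- (\<omega>\<^sup>2)) ^ k \<le> alternating_bound lo up 2 k l * (- (\<omega>\<^sup>2)) ^ k"
proof -
  have "0 \<le> (- (\<omega>\<^sup>2)) ^ k" if "even k"
    using that by (rule zero_le_even_power)
  moreover have "(- (\<omega>\<^sup>2)) ^ k \<le> 0" if "odd k"
    using that by (simp add: power_minus_odd)
  ultimately show "alternating_bound lo up 1 k l * (- (\<omega>\<^sup>2)) ^ k \<le> c * (- (\<omega>\<^sup>2)) ^ k"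
    and "c * (- (\<omega>\<^sup>2)) ^ k \<le> alternating_bound lo up 2 k l * (- (\<omega>\<^sup>2)) ^ k"
    using assms
    by (cases "even k"; simp add: alternating_bound_def mult_right_mono mult_right_mono_neg)+
qed

lemma even_value_bounds:
  assumes "\<forall>i\<le>m. a i \<in> {lo i..up i}"
  shows "even_value m \<omega> a \<in>
    {even_value m \<omega> (corner_coeff lo up 1 1)..even_value m \<omega> (corner_coeff lo up 2 2)}"
  unfolding even_value_def corner_coeff_def
  using assms by (auto intro!: sum_mono alternating_term_bounds[unfolded One_nat_def])

lemma odd_value_bounds:
  assumes "\<forall>i\<le>m. a i \<in> {lo i..up i}"
  shows "odd_value m \<omega> a \<in>
    {odd_value m \<omega> (corner_coeff lo up 1 1)..odd_value m \<omega> (corner_coeff lo up 2 2)}"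
  unfolding odd_value_def corner_coeff_def
  using assms by (auto intro!: sum_mono alternating_term_bounds[unfolded One_nat_def])

section \<open>The disc of admissible denominators\<close>

text \<open>
  For \<open>g = p + \<i>\<omega>q\<close> and \<open>f = x + \<i>\<omega>y\<close> this is \<open>Re (g * cnj f) - \<beta> * \<bar>f\<bar>\<^sup>2\<close>.
  Scaling the imaginary axis by \<open>\<omega>\<close> makes the index of a corner describe its position for every
  sign of \<open>\<omega>\<close>.
\<close>

definition margin :: "real \<Rightarrow> real \<Rightarrow> real \<Rightarrow> real \<Rightarrow> real \<Rightarrow> real \<Rightarrow> real" where
  "margin \<beta> \<omega> p q x y = p * x + \<omega>\<^sup>2 * q * y - \<beta> * (x\<^sup>2 + \<omega>\<^sup>2 * y\<^sup>2)"

lemma Re_divide_ge_iff_margin: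
  assumes "Complex x (\<omega> * y) \<noteq> 0"
  shows "\<beta> \<le> Re (Complex p (\<omega> * q) / Complex x (\<omega> * y)) \<longleftrightarrow> 0 \<le> margin \<beta> \<omega> p q x y"
proof -
  have "x\<^sup>2 + (\<omega> * y)\<^sup>2 > 0"
    using assms by (simp add: complex_eq_iff sum_power2_gt_zero_iff)
  then show ?thesis
    by (simp add: Re_divide margin_def pos_le_divide_eq power_mult_distrib power2_eq_square
        algebra_simps)
qed

lemma margin_convex:
  assumes "0 \<le> \<beta>" "0 \<le> u" "u \<le> 1"
    and "0 \<le> margin \<beta> \<omega> p q x y" "0 \<le> margin \<beta> \<omega> p q x' y'"
  shows "0 \<le> margin \<beta> \<omega> p q ((1 - u) * x + u * x') ((1 - u) * y + u * y')"
proof -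
  have "margin \<beta> \<omega> p q ((1 - u) * x + u * x') ((1 - u) * y + u * y') =
      (1 - u) * margin \<beta> \<omega> p q x y + u * margin \<beta> \<omega> p q x' y' +
      \<beta> * (u * (1 - u)) * ((x - x')\<^sup>2 + \<omega>\<^sup>2 * (y - y')\<^sup>2)"
    by (simp add: margin_def power2_eq_square algebra_simps)
  then show ?thesis
    using assms by simp
qed

lemma margin_shrink:
  assumes "0 \<le> \<beta>" "0 \<le> t" "t \<le> 1" "0 \<le> margin \<beta> \<omega> p q x y"
  shows "0 \<le> margin \<beta> \<omega> p q (t * x) (t * y)"
  using margin_convex[of \<beta> t \<omega> p q 0 0 x y] assms by (simp add: margin_def)

lemma between_imp_convex_combination:
  fixes x :: real
  assumes "x\<^sub>1 \<le> x" "x \<le> x\<^sub>2"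
  obtains u where "0 \<le> u" "u \<le> 1" "x = (1 - u) * x\<^sub>1 + u * x\<^sub>2"
proof (cases "x\<^sub>1 = x\<^sub>2")
  case True
  then show ?thesis
    using assms that[of 0] by simp
next
  case False
  define u where "u = (x - x\<^sub>1) / (x\<^sub>2 - x\<^sub>1)"
  have "u * (x\<^sub>2 - x\<^sub>1) = x - x\<^sub>1"
    using False by (simp add: u_def)
  then have "x = (1 - u) * x\<^sub>1 + u * x\<^sub>2"
    by (simp add: algebra_simps)
  moreover have "0 \<le> u" "u \<le> 1"
    using False assms by (simp_all add: u_def)
  ultimately show ?thesis
    using that by blast
qed

lemma margin_horizontal_edge:
  assumes "0 \<le> \<beta>" "x\<^sub>1 \<le> x" "x \<le> x\<^sub>2"
    and "0 \<le> margin \<beta> \<omega> p q x\<^sub>1 y" "0 \<le> margin \<beta> \<omega> p q x\<^sub>2 y"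
  shows "0 \<le> margin \<beta> \<omega> p q x y"
proof -
  obtain u where "0 \<le> u" "u \<le> 1" "x = (1 - u) * x\<^sub>1 + u * x\<^sub>2"
    using assms between_imp_convex_combination by blast
  then show ?thesis
    using margin_convex[of \<beta> u \<omega> p q x\<^sub>1 y x\<^sub>2 y] assms
    by (simp flip: distrib_right)
qed

lemma margin_vertical_edge:
  assumes "0 \<le> \<beta>" "y\<^sub>1 \<le> y" "y \<le> y\<^sub>2"
    and "0 \<le> margin \<beta> \<omega> p q x y\<^sub>1" "0 \<le> margin \<beta> \<omega> p q x y\<^sub>2"
  shows "0 \<le> margin \<beta> \<omega> p q x y"
proof -
  obtain u where "0 \<le> u" "u \<le> 1" "y = (1 - u) * y\<^sub>1 + u * y\<^sub>2"
    using assms between_imp_convex_combination by blast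
  then show ?thesis
    using margin_convex[of \<beta> u \<omega> p q x y\<^sub>1 x y\<^sub>2] assms
    by (simp flip: distrib_right)
qed

text \<open>
  A ray from the origin into the first quadrant leaves the rectangle through its upper or its right
  edge; the three corners in the hypotheses are the end points of these two edges.
\<close>

lemma margin_first_quadrant:
  assumes \<beta>: "0 \<le> \<beta>"
    and x: "0 \<le> x" "x\<^sub>1 \<le> x" "x \<le> x\<^sub>2"
    and y: "0 \<le> y" "y\<^sub>1 \<le> y" "y \<le> y\<^sub>2"
    and corners: "0 \<le> margin \<beta> \<omega> p q x\<^sub>2 y\<^sub>2" "0 \<le> margin \<beta> \<omega> p q x\<^sub>1 y\<^sub>2" "0 \<le> margin \<beta> \<omega> p q x\<^sub>2 y\<^sub>1"
  shows "0 \<le> margin \<beta> \<omega> p q x y"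
proof -
  have upper: "0 \<le> margin \<beta> \<omega> p q x' y\<^sub>2" if "x\<^sub>1 \<le> x'" "x' \<le> x\<^sub>2" for x'
    using \<beta> that corners(2,1) by (rule margin_horizontal_edge)
  have right: "0 \<le> margin \<beta> \<omega> p q x\<^sub>2 y'" if "y\<^sub>1 \<le> y'" "y' \<le> y\<^sub>2" for y'
    using \<beta> that corners(3,1) by (rule margin_vertical_edge)
  consider "x = 0" "y = 0" | "x = x\<^sub>2" | "y = y\<^sub>2"
    | "x < x\<^sub>2" "y < y\<^sub>2" "x * y\<^sub>2 \<le> y * x\<^sub>2" "x \<noteq> 0 \<or> y \<noteq> 0"
    | "x < x\<^sub>2" "y < y\<^sub>2" "y * x\<^sub>2 < x * y\<^sub>2"
    using x y by linarith
  then show ?thesis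
  proof cases
    case 1
    then show ?thesis
      by (simp add: margin_def)
  next
    case 2
    then show ?thesis
      using right y by simp
  next
    case 3
    then show ?thesis
      using upper x by simp
  next
    \<comment> \<open>The ray leaves through the upper edge, at \<open>(x / t, y\<^sub>2)\<close> with \<open>t = y / y\<^sub>2\<close>.\<close>
    case 4
    have "y \<noteq> 0"
    proof
      assume "y = 0"
      then have "x > 0" "y\<^sub>2 > 0"
        using 4 x by linarith+
      then have "x * y\<^sub>2 > 0"
        by (rule mult_pos_pos)
      then show False
        using 4 \<open>y = 0\<close> by simp
    qed
    then have pos: "0 < y" "0 < y\<^sub>2"
      using 4 y by linarith+
    define t where "t = y / y\<^sub>2"
    have t: "0 < t" "t \<le> 1" "t * y\<^sub>2 = y"
      using pos y by (simp_all add: t_def)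
    have "x \<le> x / t"
      using t x by (simp add: pos_le_divide_eq mult_left_le)
    moreover have "x / t \<le> x\<^sub>2"
      using 4 pos by (simp add: t_def pos_divide_le_eq mult.commute)
    ultimately have "0 \<le> margin \<beta> \<omega> p q (x / t) y\<^sub>2"
      using x by (intro upper) simp_all
    then have "0 \<le> margin \<beta> \<omega> p q (t * (x / t)) (t * y\<^sub>2)"
      using \<beta> t by (intro margin_shrink) simp_all
    then show ?thesis
      using t by simp
  next
    \<comment> \<open>The ray leaves through the right edge, at \<open>(x\<^sub>2, y / t)\<close> with \<open>t = x / x\<^sub>2\<close>.\<close>
    case 5
    have "0 \<le> y * x\<^sub>2"
      using x y by (intro mult_nonneg_nonneg) linarith+
    then have "x \<noteq> 0"
      using 5 by auto
    then have pos: "0 < x" "0 < x\<^sub>2"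
      using 5 x by linarith+
    define t where "t = x / x\<^sub>2"
    have t: "0 < t" "t \<le> 1" "t * x\<^sub>2 = x"
      using pos x by (simp_all add: t_def)
    have "y \<le> y / t"
      using t y by (simp add: pos_le_divide_eq mult_left_le)
    moreover have "y / t \<le> y\<^sub>2"
      using 5 pos by (simp add: t_def pos_divide_le_eq mult.commute)
    ultimately have "0 \<le> margin \<beta> \<omega> p q x\<^sub>2 (y / t)"
      using y by (intro right) simp_all
    then have "0 \<le> margin \<beta> \<omega> p q (t * x\<^sub>2) (t * (y / t))"
      using \<beta> t by (intro margin_shrink) simp_all
    then show ?thesis
      using t by simp
  qed
qed

lemma margin_reflect:
  "margin \<beta> \<omega> (- p) q (- x) y = margin \<beta> \<omega> p q x y"
  "margin \<beta> \<omega> p (- q) x (- y) = margin \<beta> \<omega> p q x y"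
  by (simp_all add: margin_def)

lemma margin_mono_numerator:
  assumes "p * x \<le> p' * x" "q * y \<le> q' * y"
  shows "margin \<beta> \<omega> p q x y \<le> margin \<beta> \<omega> p' q' x y"
  using assms(1) mult_left_mono[OF assms(2), of "\<omega>\<^sup>2"] by (simp add: margin_def mult.assoc)

text \<open>
  In each quadrant the worst numerator is the corner of the numerator rectangle with the opposite
  position, and reflecting the axes reduces the claim for the denominators to the first quadrant.
\<close>

lemma margin_rectangles:
  fixes P Q X Y :: "nat \<Rightarrow> real"
  assumes \<beta>: "0 \<le> \<beta>"
    and p: "P 1 \<le> p" "p \<le> P 2" and q: "Q 1 \<le> q" "q \<le> Q 2"
    and x: "X 1 \<le> x" "x \<le> X 2" and y: "Y 1 \<le> y" "y \<le> Y 2"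
    and corners: "\<And>i j k l. (i, j, k, l) \<in> I1 \<Longrightarrow> 0 \<le> margin \<beta> \<omega> (P i) (Q j) (X k) (Y l)"
  shows "0 \<le> margin \<beta> \<omega> p q x y"
proof -
  consider "0 \<le> x" "0 \<le> y" | "x \<le> 0" "0 \<le> y" | "x \<le> 0" "y \<le> 0" | "0 \<le> x" "y \<le> 0"
    by linarith
  then show ?thesis
  proof cases
    case 1
    have "0 \<le> margin \<beta> \<omega> (P 1) (Q 1) x y"
      using 1 \<beta> x y
      by (intro margin_first_quadrant[of \<beta> x "X 1" "X 2" y "Y 1" "Y 2"] corners) (simp_all add: I1_def)
    also have "\<dots> \<le> margin \<beta> \<omega> p q x y"
      using 1 p q by (intro margin_mono_numerator mult_right_mono)
    finally show ?thesis .
  next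
    case 2
    have "0 \<le> margin \<beta> \<omega> (- P 2) (Q 1) (- x) y"
      using 2 \<beta> x y
      by (intro margin_first_quadrant[of \<beta> "- x" "- X 2" "- X 1" y "Y 1" "Y 2"])
        (simp_all add: margin_reflect corners I1_def)
    also have "\<dots> \<le> margin \<beta> \<omega> p q x y"
      using 2 p q unfolding margin_reflect
      by (intro margin_mono_numerator mult_right_mono mult_right_mono_neg)
    finally show ?thesis .
  next
    case 3
    have "0 \<le> margin \<beta> \<omega> (- P 2) (- Q 2) (- x) (- y)"
      using 3 \<beta> x y
      by (intro margin_first_quadrant[of \<beta> "- x" "- X 2" "- X 1" "- y" "- Y 2" "- Y 1"])
        (simp_all add: margin_reflect corners I1_def)
    also have "\<dots> \<le> margin \<beta> \<omega> p q x y"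
      using 3 p q unfolding margin_reflect
      by (intro margin_mono_numerator mult_right_mono_neg)
    finally show ?thesis .
  next
    case 4
    have "0 \<le> margin \<beta> \<omega> (P 1) (- Q 2) x (- y)"
      using 4 \<beta> x y
      by (intro margin_first_quadrant[of \<beta> x "X 1" "X 2" "- y" "- Y 2" "- Y 1"])
        (simp_all add: margin_reflect corners I1_def)
    also have "\<dots> \<le> margin \<beta> \<omega> p q x y"
      using 4 p q unfolding margin_reflect
      by (intro margin_mono_numerator mult_right_mono mult_right_mono_neg)
    finally show ?thesis .
  qed
qed

section \<open>The minimum over the whole family\<close>

theorem theorem1:
  fixes m n :: nat
    and a_lo a_up b_lo b_up :: "nat \<Rightarrow> real"
    and \<omega> \<beta>\<^sub>0 :: real
  assumes "m \<le> n"
    and "\<And>i. i \<le> m \<Longrightarrow> a_lo i \<le> a_up i"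
    and "\<And>i. i \<le> n \<Longrightarrow> b_lo i \<le> b_up i"
    and "0 \<notin> {eval_j f \<omega> | f. f \<in> interval_polys n b_lo b_up}"
    and "\<beta>\<^sub>0 = Min {Re (eval_j (corner_poly m a_lo a_up i\<^sub>1 j\<^sub>1) \<omega>
                        / eval_j (corner_poly n b_lo b_up i\<^sub>2 j\<^sub>2) \<omega>)
                    | i\<^sub>1 j\<^sub>1 i\<^sub>2 j\<^sub>2. (i\<^sub>1, j\<^sub>1, i\<^sub>2, j\<^sub>2) \<in> I1}"
    and "\<beta>\<^sub>0 > 0"
  shows "is_minimum {Re (eval_j g \<omega> / eval_j f \<omega>)
                     | g f. g \<in> interval_polys m a_lo a_up \<and> f \<in> interval_polys n b_lo b_up} \<beta>\<^sub>0"
proof -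
  define r where "r = (\<lambda>(i\<^sub>1, j\<^sub>1, i\<^sub>2, j\<^sub>2). Re (eval_j (corner_poly m a_lo a_up i\<^sub>1 j\<^sub>1) \<omega>
    / eval_j (corner_poly n b_lo b_up i\<^sub>2 j\<^sub>2) \<omega>))"
  have I1: "finite I1" "I1 \<noteq> {}"
    by (simp_all add: I1_def)
  have "{Re (eval_j (corner_poly m a_lo a_up i\<^sub>1 j\<^sub>1) \<omega> / eval_j (corner_poly n b_lo b_up i\<^sub>2 j\<^sub>2) \<omega>)
      | i\<^sub>1 j\<^sub>1 i\<^sub>2 j\<^sub>2. (i\<^sub>1, j\<^sub>1, i\<^sub>2, j\<^sub>2) \<in> I1} = r ` I1"
    by (simp add: r_def image_def Bex_def conj_commute)
  then have \<beta>: "\<beta>\<^sub>0 = Min (r ` I1)"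
    using assms(5) by simp
  have nz: "eval_j f \<omega> \<noteq> 0" if "f \<in> interval_polys n b_lo b_up" for f
    using assms(4) that by force
  define P where "P i = even_value m \<omega> (corner_coeff a_lo a_up i i)" for i
  define Q where "Q i = odd_value m \<omega> (corner_coeff a_lo a_up i i)" for i
  define X where "X i = even_value n \<omega> (corner_coeff b_lo b_up i i)" for i
  define Y where "Y i = odd_value n \<omega> (corner_coeff b_lo b_up i i)" for i
  have corners: "0 \<le> margin \<beta>\<^sub>0 \<omega> (P i) (Q j) (X k) (Y l)" if "(i, j, k, l) \<in> I1" for i j k l
  proof -
    have "\<beta>\<^sub>0 \<le> r (i, j, k, l)"
      using that I1 by (simp add: \<beta>)
    moreover have "eval_j (corner_poly n b_lo b_up k l) \<omega> \<noteq> 0"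
      using corner_poly_in_interval_polys assms(3) nz by blast
    ultimately show ?thesis
      using Re_divide_ge_iff_margin
      by (simp add: r_def eval_j_corner_poly P_def Q_def X_def Y_def)
  qed
  have lower: "\<beta>\<^sub>0 \<le> Re (eval_j g \<omega> / eval_j f \<omega>)"
    if g: "g \<in> interval_polys m a_lo a_up" and f: "f \<in> interval_polys n b_lo b_up" for g f
  proof -
    obtain a where a: "\<forall>i\<le>m. a i \<in> {a_lo i..a_up i}" "g = (\<Sum>i\<le>m. monom (a i) i)"
      using g by (auto simp: interval_polys_def)
    obtain b where b: "\<forall>i\<le>n. b i \<in> {b_lo i..b_up i}" "f = (\<Sum>i\<le>n. monom (b i) i)"
      using f by (auto simp: interval_polys_def)
    have "0 \<le> margin \<beta>\<^sub>0 \<omega> (even_value m \<omega> a) (odd_value m \<omega> a) (even_value n \<omega> b) (odd_value n \<omega> b)"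
    proof (rule margin_rectangles)
      show "0 \<le> \<beta>\<^sub>0"
        using assms(6) by simp
      show "0 \<le> margin \<beta>\<^sub>0 \<omega> (P i) (Q j) (X k) (Y l)" if "(i, j, k, l) \<in> I1" for i j k l
        using that by (rule corners)
    qed (use even_value_bounds[OF a(1)] odd_value_bounds[OF a(1)]
        even_value_bounds[OF b(1)] odd_value_bounds[OF b(1)]
        in \<open>simp_all add: P_def Q_def X_def Y_def\<close>)
    then show ?thesis
      using nz[OF f] unfolding a(2) b(2) eval_j_coeffs by (simp add: Re_divide_ge_iff_margin)
  qed
  have "\<beta>\<^sub>0 \<in> r ` I1"
    unfolding \<beta> using I1 by (intro Min_in) simp_all
  then obtain i j k l where "(i, j, k, l) \<in> I1" "\<beta>\<^sub>0 = r (i, j, k, l)"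
    by (metis imageE surj_pair)
  then have "\<beta>\<^sub>0 = Re (eval_j (corner_poly m a_lo a_up i j) \<omega> / eval_j (corner_poly n b_lo b_up k l) \<omega>)"
    by (simp add: r_def)
  moreover have "corner_poly m a_lo a_up i j \<in> interval_polys m a_lo a_up"
    "corner_poly n b_lo b_up k l \<in> interval_polys n b_lo b_up"
    using corner_poly_in_interval_polys assms(2,3) by blast+
  ultimately show ?thesis
    using lower unfolding is_minimum_def by blast
qed

end
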